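(* Let $p$ be a prime, let $R$ be a commutative ring with $1$ of characteristic $p$, and let $n\ge k\ge 1$ be integers. Let $f,g\in\mathcal{N}(R)$ be such that $D(f)\ge k$ and $D(gf^{-1})\ge n$. Then for all $m\ge1$ we have $$D(g^{p^m}f^{-p^m})\ge n+(p^m-1)k+\frac{p^m-p}{p-1}k_0+e(k,n).$$
   Context: For a commutative ring $R$ with $1$ of characteristic $p$, the Nottingham group $\mathcal{N}=\mathcal{N}(R)$ is the set of all formal power series $f(x)\in R[[x]]$ with leading term $x$ (i.e. $f(x)=x+a_1x^2+a_2x^3+\cdots$), with product $(fg)(x)=f(g(x))$; powers and inverses are taken in this group. For $k\ge1$ put $\mathcal{N}_k=\{f\in\mathcal{N}: f(x)\equiv x \pmod{x^{k+1}}\}$. The depth of $f\in\mathcal{N}$ is $D(f)=\sup\{k: f\in\mathcal{N}_k\}$ (so $D(x)=\infty$). For $n\ge k\ge1$ let $k_0$ be the least nonnegative residue of $k$ modulo $p$, and define the nonnegative integer $e(k,n)$ by: - $e(k,n)=0$ if $p\mid k$ and $n=k$; - $e(k,n)=1$ if $p\mid k$, $p\mid n$ and $n>k$; - $e(k,n)=0$ if $p\mid k$ and $p\nmid n$; - $e(k,n)=i$ if $p\nmid k$ and $n\equiv 2k-i \pmod p$ for some $0\le i\le k_0$; - $e(k,n)=k_0$ if $p\nmid k$ and $n\not\equiv 2k-i\pmod p$ for all $0\le i\le k_0$. *)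

theory Defs
  imports "HOL-Computational_Algebra.Computational_Algebra" "HOL-Algebra.Group" "HOL-Library.Extended_Nat"
begin

definition nottingham :: "'a::comm_ring_1 fps monoid" where
  "nottingham =
    \<lparr>carrier = {f. fps_nth f 0 = 0 \<and> fps_nth f 1 = 1}, mult = (oo), one = fps_X\<rparr>"

definition nottingham_filtration :: "nat \<Rightarrow> 'a::comm_ring_1 fps set" where
  "nottingham_filtration k = {f \<in> carrier nottingham. fps_X ^ (k + 1) dvd f - fps_X}"

definition depth :: "'a::comm_ring_1 fps \<Rightarrow> enat" where
  "depth f = Sup (enat ` {k. 1 \<le> k \<and> f \<in> nottingham_filtration k})"

text \<open>
  The number \<open>i\<close> with \<open>attains i\<close> is unique when it exists, since \<open>i \<le> k mod p < p\<close>.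
  Only \<open>1 \<le> k \<le> n\<close> is meaningful, so \<open>n \<noteq> k\<close> stands for \<open>n > k\<close>.
\<close>

definition depth_excess :: "nat \<Rightarrow> nat \<Rightarrow> nat \<Rightarrow> nat" where
  "depth_excess p k n =
    (let attains = (\<lambda>i. i \<le> k mod p \<and> int n mod int p = (2 * int k - int i) mod int p) in
     if p dvd k then
       (if n = k then 0 else if p dvd n then 1 else 0)
     else if \<exists>i. attains i then (THE i. attains i)
     else k mod p)"

end

theory Submission
  imports Defs
begin

text \<open>
  Write \<open>D(g f\<^sup>-\<^sup>1) \<ge> n\<close> as \<open>g \<equiv> f (mod x\<^sup>n\<^sup>+\<^sup>1)\<close> (\<open>depth_quotient_ge_iff\<close>). The operator
  \<open>h \<mapsto> h \<circ> f\<close> is \<open>1 + \<Delta>\<close> with \<open>\<Delta> h = (h \<circ> f) - h\<close>, so in characteristic \<open>p\<close> its \<open>p\<close>-th power is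
  \<open>1 + \<Delta>\<^sup>p\<close> and the \<open>p\<close>-th iterate of \<open>f\<close> is \<open>x + \<Delta>\<^sup>p x\<close> (\<open>iterate_prime\<close>). Since \<open>\<Delta>\<close> raises orders
  by \<open>k\<close>, and replacing \<open>f\<close> by \<open>g\<close> in one factor raises them by \<open>n\<close>, this gives
  \<open>D(g\<^sup>p f\<^sup>-\<^sup>p) \<ge> n + (p - 1) k\<close>. If \<open>p\<close> divides \<open>k\<close> and \<open>n\<close>, and \<open>n > k\<close>, the next coefficient is \<open>p\<close> equal
  contributions, hence zero (\<open>iterate_prime_diff_dvd\<close>).

  The further gain for \<open>k\<close> prime to \<open>p\<close> comes from commutation (\<open>commuting_gain\<close>). Put \<open>P = g\<^sup>p\<close> and
  \<open>Q = f\<^sup>p\<close>, let \<open>P - Q = c x\<^sup>d\<^sup>+\<^sup>1 + \<dots>\<close>, and let \<open>a\<close> be the coefficient of \<open>x\<^sup>k\<^sup>+\<^sup>1\<close> in \<open>g\<close>. Comparing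
  coefficients of \<open>x\<^sup>d\<^sup>+\<^sup>k\<^sup>+\<^sup>1\<close> in \<open>g \<circ> P = P \<circ> g\<close> and using that \<open>f\<close> commutes with \<open>Q\<close> yields
  \<open>(d - k) a c = 0\<close>, as long as \<open>d + k < n + D(Q)\<close>. An integer prime to \<open>p\<close> is a unit in \<open>R\<close>, so if \<open>a\<close>
  can be cancelled, then \<open>d\<close> can be increased
  until \<open>d \<equiv> k (mod p)\<close> or \<open>d + k = n + D(Q)\<close>. The case in which \<open>f\<close> is the identity and \<open>g\<close> is the
  given \<open>f\<close> shows \<open>D(f\<^sup>p) \<ge> p k + k\<^sub>0\<close>, and then the two obstacles for \<open>d = n + (p - 1) k + i\<close> are
  \<open>n \<equiv> 2 k - i\<close> and \<open>i = k\<^sub>0\<close>: the gain so obtained is \<open>e(k, n)\<close> (\<open>depth_excess_not_dvd\<close>).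

  To make \<open>a\<close> cancellable over an arbitrary ring \<open>R\<close>, one works over \<open>R[t]\<close> with \<open>f + t x\<^sup>k\<^sup>+\<^sup>1\<close> and
  \<open>g + t x\<^sup>k\<^sup>+\<^sup>1\<close>, where the coefficient is monic in \<open>t\<close>, and then sets \<open>t = 0\<close>
  (\<open>iterate_prime_diff_gain\<close>).

  For \<open>p\<^sup>m\<close> the bound for \<open>p\<close> is iterated. After the first step the excess is at least \<open>k\<^sub>0\<close>
  (\<open>depth_excess_next\<close>), which together with the growth of the depth of the iterates of \<open>f\<close> produces the
  multiple of \<open>k\<^sub>0\<close> in the statement (\<open>iterate_prime_power_diff\<close>).
\<close>

section \<open>Composition of power series over a commutative ring\<close>

lemma fps_power_nth_eq_0:
  fixes c :: "'a::comm_ring_1 fps"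
  assumes "c $ 0 = 0" "n < k"
  shows "(c ^ k) $ n = 0"
  using startsby_zero_power_prefix[OF assms(1)] assms(2) by blast

text \<open>
  Up to order \<open>n\<close>, composition with \<open>c\<close> is a polynomial expression in \<open>c\<close>. This turns the
  multiplicativity of composition into an identity between finite sums, which holds even when
  \<open>'a\<close> has zero divisors.
\<close>

lemma fps_compose_nth_truncated:
  fixes a c :: "'a::comm_ring_1 fps"
  assumes "c $ 0 = 0" "m \<le> n"
  shows "(a oo c) $ m = (\<Sum>i\<le>n. fps_const (a $ i) * c ^ i) $ m"
proof -
  have "(a oo c) $ m = (\<Sum>i\<in>{0..m}. a $ i * (c ^ i) $ m)"
    by (simp add: fps_compose_nth)
  also have "\<dots> = (\<Sum>i\<le>n. a $ i * (c ^ i) $ m)"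
    by (rule sum.mono_neutral_left) (use assms fps_power_nth_eq_0[OF assms(1)] in auto)
  finally show ?thesis by (simp add: fps_sum_nth)
qed

lemma fps_compose_mult:
  fixes a b c :: "'a::comm_ring_1 fps"
  assumes c0: "c $ 0 = 0"
  shows "(a * b) oo c = (a oo c) * (b oo c)"
proof (rule fps_ext)
  fix n
  let ?A = "\<Sum>i\<le>n. fps_const (a $ i) * c ^ i" and ?B = "\<Sum>i\<le>n. fps_const (b $ i) * c ^ i"
  have "((a oo c) * (b oo c)) $ n = (?A * ?B) $ n"
    unfolding fps_mult_nth
    by (intro sum.cong refl) (simp only: fps_compose_nth_truncated[OF c0, of _ n] atLeastAtMost_iff diff_le_self)
  also have "?A * ?B = (\<Sum>i\<le>n. \<Sum>j\<le>n. fps_const (a $ i * b $ j) * c ^ (i + j))"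
    by (simp add: sum_product power_add mult_ac flip: fps_const_mult)
  also have "\<dots> $ n = (\<Sum>(i, j)\<in>{..n} \<times> {..n}. a $ i * b $ j * (c ^ (i + j)) $ n)"
    by (simp add: fps_sum_nth) (simp add: sum.cartesian_product)
  also have "\<dots> = (\<Sum>(i, j)\<in>{(i, j). i + j \<le> n}. a $ i * b $ j * (c ^ (i + j)) $ n)"
    by (rule sum.mono_neutral_right) (auto, metis c0 fps_power_nth_eq_0 leI mult_zero_right)
  also have "\<dots> = (\<Sum>s=0..n. \<Sum>i=0..s. a $ i * b $ (s - i) * (c ^ s) $ n)"
    by (rule sum_pair_less_iff)
  also have "\<dots> = ((a * b) oo c) $ n"
    by (simp add: fps_compose_nth fps_mult_nth sum_distrib_right)
  finally show "((a * b) oo c) $ n = ((a oo c) * (b oo c)) $ n" ..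
qed

lemma fps_compose_power_right:
  fixes a c :: "'a::comm_ring_1 fps"
  assumes "c $ 0 = 0"
  shows "a ^ n oo c = (a oo c) ^ n"
  by (induction n) (simp_all add: fps_compose_mult[OF assms])

lemma fps_compose_associative:
  fixes a b c :: "'a::comm_ring_1 fps"
  assumes c0: "c $ 0 = 0" and b0: "b $ 0 = 0"
  shows "(a oo b) oo c = a oo (b oo c)"
proof (rule fps_ext)
  fix n
  have "(a oo (b oo c)) $ n = (\<Sum>i=0..n. a $ i * (\<Sum>j=0..n. (b ^ i) $ j * (c ^ j) $ n))"
    by (simp add: fps_compose_nth flip: fps_compose_power_right[OF c0])
  also have "\<dots> = (\<Sum>j=0..n. (\<Sum>i=0..n. a $ i * (b ^ i) $ j) * (c ^ j) $ n)"
    by (simp add: sum_distrib_left sum_distrib_right mult.assoc) (rule sum.swap)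
  also have "\<dots> = (\<Sum>j=0..n. (a oo b) $ j * (c ^ j) $ n)"
    by (intro sum.cong refl)
      (simp add: fps_compose_nth_truncated[OF b0, of _ n] fps_sum_nth atLeast0AtMost)
  finally show "((a oo b) oo c) $ n = (a oo (b oo c)) $ n"
    by (simp add: fps_compose_nth)
qed

section \<open>The Nottingham group\<close>

text \<open>
  The coefficients of the series \<open>h\<close> with \<open>h \<circ> f = x\<close>: as \<open>f\<^sup>n\<close> has leading term \<open>x\<^sup>n\<close>, the \<open>n\<close>-th
  coefficient of \<open>h \<circ> f\<close> is that of \<open>h\<close> plus terms in earlier coefficients, so it can be solved for.
\<close>

fun left_inverse_coeff :: "'a::comm_ring_1 fps \<Rightarrow> nat \<Rightarrow> 'a" where
  "left_inverse_coeff f n =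
    (if n = 1 then 1 else 0) - (\<Sum>i<n. left_inverse_coeff f i * (f ^ i) $ n)"

declare left_inverse_coeff.simps [simp del]

lemma nottingham_carrier_iff:
  "f \<in> carrier nottingham \<longleftrightarrow> f $ 0 = 0 \<and> f $ 1 = 1"
  by (simp add: nottingham_def)

lemma nottingham_mult [simp]: "f \<otimes>\<^bsub>nottingham\<^esub> g = f oo g"
  by (simp add: nottingham_def)

lemma nottingham_one [simp]: "\<one>\<^bsub>nottingham\<^esub> = fps_X"
  by (simp add: nottingham_def)

lemma fps_power_nth_self:
  fixes f :: "'a::comm_ring_1 fps"
  assumes "f \<in> carrier nottingham"
  shows "(f ^ n) $ n = 1"
  using startsby_zero_power_nth_same[of f n] assms by (simp add: nottingham_carrier_iff)

lemma nottingham_compose_closed: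
  fixes f g :: "'a::comm_ring_1 fps"
  assumes "f \<in> carrier nottingham" "g \<in> carrier nottingham"
  shows "f oo g \<in> carrier nottingham"
  using assms by (auto simp: nottingham_carrier_iff fps_compose_nth)

lemma left_inverse:
  fixes f :: "'a::comm_ring_1 fps"
  assumes f: "f \<in> carrier nottingham"
  shows "Abs_fps (left_inverse_coeff f) \<in> carrier nottingham"
    and "Abs_fps (left_inverse_coeff f) oo f = fps_X"
proof -
  show "Abs_fps (left_inverse_coeff f) \<in> carrier nottingham"
    using left_inverse_coeff.simps[of f 0] left_inverse_coeff.simps[of f 1]
    by (simp add: nottingham_carrier_iff)
  show "Abs_fps (left_inverse_coeff f) oo f = fps_X"
  proof (rule fps_ext)
    fix n
    have "(Abs_fps (left_inverse_coeff f) oo f) $ n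
        = (\<Sum>i<n. left_inverse_coeff f i * (f ^ i) $ n) + left_inverse_coeff f n"
      using fps_power_nth_self[OF f, of n]
      by (simp add: fps_compose_nth atLeast0AtMost lessThan_Suc_atMost [symmetric])
    then show "(Abs_fps (left_inverse_coeff f) oo f) $ n = fps_X $ n"
      using left_inverse_coeff.simps[of f n] by simp
  qed
qed

lemma group_nottingham: "group (nottingham :: 'a::comm_ring_1 fps monoid)"
proof (rule groupI)
  fix f g h :: "'a fps"
  assume *: "f \<in> carrier nottingham" "g \<in> carrier nottingham" "h \<in> carrier nottingham"
  then show "f \<otimes>\<^bsub>nottingham\<^esub> g \<otimes>\<^bsub>nottingham\<^esub> h = f \<otimes>\<^bsub>nottingham\<^esub> (g \<otimes>\<^bsub>nottingham\<^esub> h)"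
    by (simp add: nottingham_carrier_iff fps_compose_associative)
next
  fix f :: "'a fps" assume "f \<in> carrier nottingham"
  then show "\<exists>h\<in>carrier nottingham. h \<otimes>\<^bsub>nottingham\<^esub> f = \<one>\<^bsub>nottingham\<^esub>"
    using left_inverse by (intro bexI[of _ "Abs_fps (left_inverse_coeff f)"]) auto
qed (auto simp: nottingham_compose_closed, auto simp: nottingham_carrier_iff)

interpretation nottingham: group "nottingham :: 'a::comm_ring_1 fps monoid"
  by (rule group_nottingham)

section \<open>Orders of vanishing under substitution\<close>

text \<open>
  The coefficient \<open>c\<close> may be zero: \<open>lead d 0 h\<close> says that \<open>x\<^sup>d\<^sup>+\<^sup>1\<close> divides \<open>h\<close>. So one notion
  carries both orders of vanishing and leading coefficients, and it is multiplicative over any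
  commutative ring.
\<close>

definition lead :: "nat \<Rightarrow> 'a::comm_ring_1 \<Rightarrow> 'a fps \<Rightarrow> bool" where
  "lead d c h \<longleftrightarrow> (\<forall>i<d. h $ i = 0) \<and> h $ d = c"

lemma lead_add: "lead d a h \<Longrightarrow> lead d b h' \<Longrightarrow> lead d (a + b) (h + h')"
  by (auto simp: lead_def)

lemma lead_diff: "lead d a h \<Longrightarrow> lead d b h' \<Longrightarrow> lead d (a - b) (h - h')"
  by (auto simp: lead_def)

lemma lead_sum:
  "(\<And>i. i \<in> A \<Longrightarrow> lead d (c i) (h i)) \<Longrightarrow> lead d (\<Sum>i\<in>A. c i) (\<Sum>i\<in>A. h i)"
  by (induction A rule: infinite_finite_induct) (auto simp: lead_def)

lemma lead_mult:
  assumes "lead d a h" "lead e b h'"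
  shows "lead (d + e) (a * b) (h * h')"
proof -
  have "h $ i * h' $ (n - i) = (if n = d + e \<and> i = d then a * b else 0)"
    if "n \<le> d + e" "i \<le> n" for n i
    using that assms by (cases i d rule: linorder_cases) (auto simp: lead_def)
  then have "(h * h') $ n = (if n = d + e then a * b else 0)" if "n \<le> d + e" for n
    using that by (auto simp: fps_mult_nth)
  then show ?thesis by (simp add: lead_def)
qed

lemma lead_power: "lead d a h \<Longrightarrow> lead (n * d) (a ^ n) (h ^ n)"
proof (induction n)
  case 0
  show ?case by (simp add: lead_def)
next
  case (Suc n)
  then show ?case using lead_mult[of d a h "n * d" "a ^ n" "h ^ n"] by simp
qed

lemma lead_weaken: "lead d a h \<Longrightarrow> e < d \<Longrightarrow> lead e 0 h"
  by (auto simp: lead_def)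

lemma lead_mono: "lead d 0 h \<Longrightarrow> e \<le> d \<Longrightarrow> lead e 0 h"
  by (auto simp: lead_def le_less)

lemma lead_Suc: "lead d 0 h \<Longrightarrow> lead (Suc d) (h $ Suc d) h"
  by (auto simp: lead_def less_Suc_eq)

lemma lead_obtain_quotient:
  assumes "lead d c h"
  obtains q where "h = fps_X ^ d * q" "q $ 0 = c"
proof
  show "h = fps_X ^ d * fps_shift d h"
    using assms by (simp add: fps_eq_iff fps_X_power_mult_nth lead_def)
  show "fps_shift d h $ 0 = c"
    using assms by (simp add: lead_def)
qed

lemma X_power_dvd_iff_lead: "fps_X ^ (d + 1) dvd h \<longleftrightarrow> lead d 0 h"
proof
  assume "fps_X ^ (d + 1) dvd h"
  then show "lead d 0 h" by (auto simp: lead_def fps_X_power_mult_nth simp del: power_Suc)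
next
  assume "lead d 0 h"
  then have "lead (Suc d) (h $ Suc d) h" by (rule lead_Suc)
  then show "fps_X ^ (d + 1) dvd h" by (metis Suc_eq_plus1 lead_obtain_quotient dvd_triv_left)
qed

lemma lead_0I: "lead 0 (h $ 0) h"
  by (simp add: lead_def)

lemma lead_compose_diff_0:
  assumes u: "u $ 0 = 0" and s: "s $ 0 = 0" and w: "lead (Suc d) c (s - u)"
  shows "lead d 0 ((h oo s) - (h oo u))"
proof -
  have "(s ^ i) $ n = (u ^ i) $ n" if "n \<le> d" for i n
  proof -
    have "s ^ i - u ^ i = (s - u) * (\<Sum>j<i. u ^ (i - Suc j) * s ^ j)"
      by (rule power_diff_sumr2)
    moreover have "lead (Suc d + 0) (c * (\<Sum>j<i. u ^ (i - Suc j) * s ^ j) $ 0) \<dots>"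
      by (rule lead_mult[OF w lead_0I])
    ultimately have "(s ^ i - u ^ i) $ n = 0"
      using that by (simp add: lead_def)
    then show ?thesis by simp
  qed
  then show ?thesis
    by (simp add: lead_def fps_compose_nth)
qed

text \<open>
  The first-order Taylor formula \<open>h(u + w) - h(u) \<approx> h'(u) w\<close> at the level of leading terms. With
  \<open>h = x\<^sup>b q\<close>, replacing \<open>q(u)\<close> by \<open>q(u + w)\<close> only
  matters from order \<open>b + e + 1\<close> on; the leading term comes from
  \<open>(u + w)\<^sup>b - u\<^sup>b\<close>, that is, \<open>w\<close> times a sum of \<open>b\<close> products with leading term \<open>x\<^sup>b\<^sup>-\<^sup>1\<close>.
\<close>

lemma lead_compose_increment:
  assumes h: "lead b \<beta> h" and u: "lead 1 1 u" and w: "lead (Suc e) \<epsilon> w" and "1 \<le> e"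
  shows "lead (b + e) (of_nat b * \<beta> * \<epsilon>) ((h oo (u + w)) - (h oo u))"
proof -
  define s where "s = u + w"
  have s: "lead 1 1 s"
    using u w \<open>1 \<le> e\<close> unfolding s_def lead_def by auto
  have s0: "s $ 0 = 0" and u0: "u $ 0 = 0"
    using s u by (auto simp: lead_def)
  obtain q where q: "h = fps_X ^ b * q" "q $ 0 = \<beta>"
    using lead_obtain_quotient[OF h] by blast
  define T where "T = (\<Sum>i<b. u ^ (b - Suc i) * s ^ i)"
  have T: "lead (b - 1) (of_nat b) T"
  proof -
    have "lead (b - 1) (1 :: 'a) (u ^ (b - Suc i) * s ^ i)" if "i < b" for i
      using lead_mult[OF lead_power[OF u, of "b - Suc i"] lead_power[OF s, of i]] that by simp
    then have "lead (b - 1) (\<Sum>i<b. 1 :: 'a) T"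
      unfolding T_def by (intro lead_sum) auto
    then show ?thesis by simp
  qed
  have wT: "lead (b + e) (\<epsilon> * of_nat b) (w * T)"
  proof (cases "b = 0")
    case True
    then show ?thesis by (simp add: T_def lead_def)
  next
    case False
    then show ?thesis using lead_mult[OF w T] by (simp add: add.commute)
  qed
  have "(h oo s) - (h oo u) = s ^ b * (q oo s) - u ^ b * (q oo u)"
    using s0 u0 by (simp add: q fps_compose_mult fps_compose_power_right)
  also have "\<dots> = (s ^ b - u ^ b) * (q oo s) + u ^ b * ((q oo s) - (q oo u))"
    by (simp add: algebra_simps)
  also have "s ^ b - u ^ b = w * T"
    using power_diff_sumr2[of s b u] by (simp add: T_def s_def)
  finally have eq: "(h oo s) - (h oo u) = w * T * (q oo s) + u ^ b * ((q oo s) - (q oo u))" .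
  have "lead (b + e + 0) (\<epsilon> * of_nat b * (q oo s) $ 0) (w * T * (q oo s))"
    by (rule lead_mult[OF wT lead_0I])
  moreover have "lead (b * 1 + e) (1 ^ b * 0) (u ^ b * ((q oo s) - (q oo u)))"
    by (rule lead_mult[OF lead_power[OF u]], rule lead_compose_diff_0[OF u0 s0]) (use w in \<open>simp add: s_def\<close>)
  ultimately have "lead (b + e) (\<epsilon> * of_nat b * \<beta> + 0) ((h oo s) - (h oo u))"
    unfolding eq by (intro lead_add) (simp_all add: q)
  then show ?thesis by (simp add: s_def mult_ac)
qed

section \<open>Prime powers in characteristic p\<close>

abbreviation iterate :: "'a::comm_ring_1 fps \<Rightarrow> nat \<Rightarrow> 'a fps" where
  "iterate f j \<equiv> f [^]\<^bsub>nottingham\<^esub> j"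

lemma fps_X_nottingham: "fps_X \<in> carrier nottingham"
  by (simp add: nottingham_carrier_iff)

lemma iterate_X: "iterate fps_X j = (fps_X :: 'a::comm_ring_1 fps)"
  using nottingham.nat_pow_one[where 'a = 'a] by simp

definition compose_diff :: "'a::comm_ring_1 fps \<Rightarrow> 'a fps \<Rightarrow> 'a fps" where
  "compose_diff f h = (h oo f) - h"

lemma iterate_closed: "f \<in> carrier nottingham \<Longrightarrow> iterate f j \<in> carrier nottingham"
  for f :: "'a::comm_ring_1 fps"
  by (rule nottingham.nat_pow_closed)

lemma fps_of_nat_mult_compose:
  fixes h f :: "'a::comm_ring_1 fps"
  shows "(of_nat c * h) oo f = of_nat c * (h oo f)"
  by (simp add: fps_of_nat [symmetric] fps_const_mult_apply_left)

text \<open>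
  Composition with \<open>f\<close> is the linear operator \<open>1 + \<Delta>\<close>, where \<open>\<Delta> = compose_diff f\<close>; this is the
  binomial expansion of its \<open>j\<close>-th power.
\<close>

lemma compose_iterate_binomial:
  fixes f h :: "'a::comm_ring_1 fps"
  assumes f: "f \<in> carrier nottingham"
  shows "h oo iterate f j = (\<Sum>i\<le>j. of_nat (j choose i) * (compose_diff f ^^ i) h)"
proof (induction j)
  case 0
  then show ?case by simp
next
  case (Suc j)
  let ?D = "\<lambda>i. (compose_diff f ^^ i) h"
  have step: "?D i oo f = ?D i + ?D (Suc i)" for i
    by (simp add: compose_diff_def)
  have "h oo iterate f (Suc j) = (h oo iterate f j) oo f"
    using f iterate_closed[OF f, of j]
    by (simp add: nottingham_carrier_iff fps_compose_associative)
  also have "\<dots> = (\<Sum>i\<le>j. of_nat (j choose i) * (?D i + ?D (Suc i)))"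
    by (simp only: Suc.IH fps_compose_sum_distrib fps_of_nat_mult_compose step)
  also have "\<dots> = (\<Sum>i\<le>j. of_nat (j choose i) * ?D i) + (\<Sum>i\<le>j. of_nat (j choose i) * ?D (Suc i))"
    by (simp only: distrib_left sum.distrib)
  also have "(\<Sum>i\<le>j. of_nat (j choose i) * ?D i) = (\<Sum>i\<le>Suc j. of_nat (j choose i) * ?D i)"
    by (simp add: binomial_eq_0)
  also have "\<dots> = ?D 0 + (\<Sum>i\<le>j. of_nat (j choose Suc i) * ?D (Suc i))"
    by (subst sum.atMost_Suc_shift) simp
  also have "\<dots> + (\<Sum>i\<le>j. of_nat (j choose i) * ?D (Suc i))
      = (\<Sum>i\<le>Suc j. of_nat (Suc j choose i) * ?D i)"
    by (subst sum.atMost_Suc_shift) (simp add: sum.distrib algebra_simps del: funpow.simps)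
  finally show ?case .
qed

lemma iterate_prime:
  fixes f :: "'a::comm_ring_1 fps"
  assumes f: "f \<in> carrier nottingham" and p: "prime p" "of_nat p = (0 :: 'a)"
  shows "iterate f p = fps_X + (compose_diff f ^^ p) fps_X"
proof -
  have p0: "0 < p" using p by (simp add: prime_gt_0_nat)
  have "of_nat (p choose i) = (0 :: 'a fps)" if "0 < i" "i < p" for i
  proof -
    have "p dvd (p choose i)"
      using dvd_choose_prime[of i p] that p by simp
    then show ?thesis using p by (auto simp: fps_of_nat [symmetric])
  qed
  then have "(\<Sum>i\<le>p. of_nat (p choose i) * (compose_diff f ^^ i) fps_X)
      = (\<Sum>i\<in>{0, p}. of_nat (p choose i) * (compose_diff f ^^ i) fps_X)"
    by (intro sum.mono_neutral_right) auto
  moreover have "fps_X oo iterate f p = iterate f p"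
    using iterate_closed[OF f, of p] by (simp add: nottingham_carrier_iff)
  ultimately show ?thesis
    using compose_iterate_binomial[OF f, of fps_X p] p0 by simp
qed

lemma nottingham_carrier_iff_lead: "f \<in> carrier nottingham \<longleftrightarrow> lead 1 1 f"
  by (auto simp: lead_def nottingham_carrier_iff)

lemma lead_compose_change:
  fixes f g h :: "'a::comm_ring_1 fps"
  assumes "f \<in> carrier nottingham" "lead b \<beta> h" "lead (Suc n) c (g - f)" "1 \<le> n"
  shows "lead (b + n) (of_nat b * \<beta> * c) ((h oo g) - (h oo f))"
  using lead_compose_increment[of b \<beta> h f n c "g - f"] assms by (simp add: nottingham_carrier_iff_lead)

lemma lead_compose_diff:
  fixes f h :: "'a::comm_ring_1 fps"
  assumes "lead b \<beta> h" "lead (Suc k) a (f - fps_X)" "1 \<le> k"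
  shows "lead (b + k) (of_nat b * \<beta> * a) (compose_diff f h)"
  using lead_compose_change[of fps_X b \<beta> h k a f] assms
  by (simp add: nottingham_carrier_iff compose_diff_def)

text \<open>
  The discrete product rule: a change from \<open>(f, h)\<close> to \<open>(g, h')\<close> is a change of the series,
  followed by a change of the substitution.
\<close>

lemma compose_diff_split:
  "compose_diff g h' - compose_diff f h = compose_diff g (h' - h) + ((h oo g) - (h oo f))"
  by (simp add: compose_diff_def fps_compose_sub_distrib)

lemma lead_compose_diff_power:
  assumes "lead b \<beta> h" "lead (Suc k) a (f - fps_X)" "1 \<le> k"
  shows "\<exists>\<gamma>. lead (b + m * k) \<gamma> ((compose_diff f ^^ m) h)"
proof (induction m)
  case 0
  show ?case using assms by auto
next
  case (Suc m)
  then obtain \<gamma> where "lead (b + m * k) \<gamma> ((compose_diff f ^^ m) h)" by blast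
  from lead_compose_diff[OF this assms(2,3)] show ?case
    by (auto simp: add_ac)
qed

text \<open>
  Each application of \<open>compose_diff\<close> raises the order by \<open>k\<close>, except that replacing \<open>f\<close> by \<open>g\<close> in
  one of them raises it by \<open>n\<close>.
\<close>

lemma lead_compose_diff_power_diff:
  fixes f g h :: "'a::comm_ring_1 fps"
  assumes f: "f \<in> carrier nottingham"
    and h: "lead b \<beta> h"
    and fk: "lead (Suc k) a (f - fps_X)" and gk: "lead (Suc k) a' (g - fps_X)"
    and gf: "lead (Suc n) c (g - f)" and k: "1 \<le> k" "1 \<le> n"
  shows "\<exists>\<gamma>. lead (b + n + m * k) \<gamma> ((compose_diff g ^^ Suc m) h - (compose_diff f ^^ Suc m) h)"
proof (induction m)
  case 0
  then show ?case
    using lead_compose_change[OF f h gf k(2)] by (auto simp: compose_diff_def)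
next
  case (Suc m)
  let ?F = "(compose_diff f ^^ Suc m) h" and ?G = "(compose_diff g ^^ Suc m) h"
  obtain \<gamma> where \<gamma>: "lead (b + n + m * k) \<gamma> (?G - ?F)" using Suc by blast
  obtain \<alpha> where \<alpha>: "lead (b + Suc m * k) \<alpha> ?F"
    using lead_compose_diff_power[OF h fk k(1)] by blast
  have "b + Suc m * k + n = b + n + m * k + k" by simp
  from lead_add[OF lead_compose_diff[OF \<gamma> gk k(1)] lead_compose_change[OF f \<alpha> gf k(2), unfolded this]]
  show ?case
    unfolding funpow.simps(2)[of "Suc m"] comp_apply compose_diff_split
    by (auto simp: add_ac simp del: funpow.simps)
qed

text \<open>
  When \<open>k\<close> and \<open>n\<close> vanish in \<open>'a\<close>, every factor \<open>of_nat b\<close> coming from \<open>lead_compose_increment\<close>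
  is one, so the \<open>Suc m\<close> positions in which \<open>f\<close> can be replaced by \<open>g\<close> contribute equally.
\<close>

lemma lead_compose_diff_power_diff_exact:
  fixes f g h :: "'a::comm_ring_1 fps"
  assumes f: "f \<in> carrier nottingham"
    and h: "lead b 1 h"
    and fk: "lead (Suc k) a (f - fps_X)" and gk: "lead (Suc k) a (g - fps_X)"
    and gf: "lead (Suc n) c (g - f)" and k: "1 \<le> k" "1 \<le> n"
    and char: "of_nat b = (1 :: 'a)" "of_nat k = (0 :: 'a)" "of_nat n = (0 :: 'a)"
  shows "lead (b + Suc m * k) (a ^ Suc m) ((compose_diff f ^^ Suc m) h)
    \<and> lead (b + n + m * k) (of_nat (Suc m) * c * a ^ m)
        ((compose_diff g ^^ Suc m) h - (compose_diff f ^^ Suc m) h)"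
proof (induction m)
  case 0
  then show ?case
    using lead_compose_change[OF f h gf k(2)] lead_compose_diff[OF h fk k(1)] 
    by (auto simp: compose_diff_def char)
next
  case (Suc m)
  let ?F = "(compose_diff f ^^ Suc m) h" and ?G = "(compose_diff g ^^ Suc m) h"
  have \<gamma>: "lead (b + n + m * k) (of_nat (Suc m) * c * a ^ m) (?G - ?F)"
    and \<alpha>: "lead (b + Suc m * k) (a ^ Suc m) ?F" using Suc by blast+
  have eq: "b + Suc m * k + n = b + n + m * k + k" by simp
  have 1: "lead (b + Suc (Suc m) * k) (a ^ Suc (Suc m)) (compose_diff f ?F)"
    using lead_compose_diff[OF \<alpha> fk k(1)] by (simp add: char add_ac mult_ac del: funpow.simps)
  have "lead (b + n + m * k + k)
      (of_nat (b + n + m * k) * (of_nat (Suc m) * c * a ^ m) * a + of_nat (b + Suc m * k) * a ^ Suc m * c)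
      (compose_diff g ?G - compose_diff f ?F)"
    unfolding compose_diff_split
    using lead_add[OF lead_compose_diff[OF \<gamma> gk k(1)] lead_compose_change[OF f \<alpha> gf k(2), unfolded eq]] .
  moreover have "of_nat (b + n + m * k) * (of_nat (Suc m) * c * a ^ m) * a + of_nat (b + Suc m * k) * a ^ Suc m * c
      = of_nat (Suc (Suc m)) * c * a ^ Suc m"
    by (simp add: char algebra_simps)
  ultimately have "lead (b + n + Suc m * k) (of_nat (Suc (Suc m)) * c * a ^ Suc m)
      (compose_diff g ?G - compose_diff f ?F)"
    by (simp add: add_ac del: funpow.simps)
  with 1 show ?case
    unfolding funpow.simps(2)[of "Suc m"] comp_apply by blast
qed

lemma iterate_prime_diff_basic:
  fixes f g :: "'a::comm_ring_1 fps"
  assumes p: "prime p" "of_nat p = (0 :: 'a)"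
    and fg: "f \<in> carrier nottingham" "g \<in> carrier nottingham"
    and k: "1 \<le> k" "k \<le> n"
    and fk: "lead k 0 (f - fps_X)" and gf: "lead n 0 (g - f)"
  shows "lead (n + (p - 1) * k) 0 (iterate g p - iterate f p)"
proof -
  have "lead k 0 (g - f)"
    using gf k(2) by (rule lead_mono)
  from lead_add[OF this fk] have gk: "lead k 0 (g - fps_X)" by simp
  obtain m where m: "p = Suc m" using p(1) prime_gt_0_nat[of p] by (cases p) auto
  have X: "lead 1 1 (fps_X :: 'a fps)" by (simp add: lead_def)
  obtain \<gamma> where "lead (1 + n + m * k) \<gamma>
      ((compose_diff g ^^ Suc m) fps_X - (compose_diff f ^^ Suc m) fps_X)"
    using lead_compose_diff_power_diff[OF fg(1) X lead_Suc[OF fk] lead_Suc[OF gk] lead_Suc[OF gf]] k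
    by fastforce
  then have "lead (n + m * k) 0 ((compose_diff g ^^ p) fps_X - (compose_diff f ^^ p) fps_X)"
    unfolding m by (rule lead_weaken) simp
  then show ?thesis
    unfolding iterate_prime[OF fg(1) p] iterate_prime[OF fg(2) p]
    by (simp add: m del: funpow.simps)
qed

text \<open>
  The leading coefficient found in \<open>lead_compose_diff_power_diff_exact\<close> is a multiple of \<open>p\<close>.
  The hypothesis \<open>k < n\<close> makes \<open>f\<close> and \<open>g\<close> agree in the coefficient of \<open>x\<^sup>k\<^sup>+\<^sup>1\<close>.
\<close>

lemma iterate_prime_diff_dvd:
  fixes f g :: "'a::comm_ring_1 fps"
  assumes p: "prime p" "of_nat p = (0 :: 'a)"
    and fg: "f \<in> carrier nottingham" "g \<in> carrier nottingham"
    and k: "1 \<le> k" "k < n" "p dvd k" "p dvd n"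
    and fk: "lead k 0 (f - fps_X)" and gf: "lead n 0 (g - f)"
  shows "lead (n + (p - 1) * k + 1) 0 (iterate g p - iterate f p)"
proof -
  define a where "a = (f - fps_X) $ Suc k"
  have fk': "lead (Suc k) a (f - fps_X)" unfolding a_def by (rule lead_Suc[OF fk])
  have "lead (Suc k) 0 (g - f)"
    using gf by (rule lead_mono) (use k in simp)
  from lead_add[OF this fk'] have gk': "lead (Suc k) a (g - fps_X)" by simp
  obtain m where m: "p = Suc m" using p(1) prime_gt_0_nat[of p] by (cases p) auto
  have X: "lead 1 1 (fps_X :: 'a fps)" by (simp add: lead_def)
  have char: "of_nat k = (0 :: 'a)" "of_nat n = (0 :: 'a)"
    using k p by (auto elim!: dvdE)
  have "lead (1 + n + m * k) (of_nat (Suc m) * (g - f) $ Suc n * a ^ m)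
      ((compose_diff g ^^ Suc m) fps_X - (compose_diff f ^^ Suc m) fps_X)"
    using lead_compose_diff_power_diff_exact[OF fg(1) X fk' gk' lead_Suc[OF gf], of m] k char
    by simp
  then have "lead (1 + n + m * k) 0 ((compose_diff g ^^ p) fps_X - (compose_diff f ^^ p) fps_X)"
    unfolding m [symmetric] p(2) by simp
  then show ?thesis
    unfolding iterate_prime[OF fg(1) p] iterate_prime[OF fg(2) p]
    by (simp add: m del: funpow.simps)
qed

section \<open>Improving the bound by commutation\<close>

text \<open>
  Let \<open>c\<close> be the coefficient of \<open>x\<^sup>d\<^sup>+\<^sup>1\<close> in \<open>P - Q\<close>. In \<open>g \<circ> P = P \<circ> g\<close> the coefficients of
  \<open>x\<^sup>d\<^sup>+\<^sup>k\<^sup>+\<^sup>1\<close> differ by \<open>(d - k) a c\<close>, apart from the failure of \<open>g\<close> to commute with \<open>Q\<close>. As \<open>f\<close>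
  commutes with \<open>Q\<close>, that failure only starts at order \<open>n + r + 1 > d + k + 1\<close>, hence \<open>(d - k) a c = 0\<close>.
\<close>

lemma commuting_gain:
  fixes f g P Q :: "'a::comm_ring_1 fps"
  assumes carr: "f \<in> carrier nottingham" "g \<in> carrier nottingham" "Q \<in> carrier nottingham"
    and commute: "g oo P = P oo g" "f oo Q = Q oo f"
    and gk: "lead (Suc k) a (g - fps_X)" and gf: "lead n 0 (g - f)"
    and Q: "lead r 0 (Q - fps_X)" and PQ: "lead d 0 (P - Q)"
    and pos: "1 \<le> k" "1 \<le> n" "1 \<le> r" "1 \<le> d" and small: "d + k < n + r"
    and cancel: "\<And>c. (of_nat d - of_nat k) * a * c = 0 \<Longrightarrow> c = 0"
  shows "lead (Suc d) 0 (P - Q)"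
proof -
  define w where "w = P - Q"
  define c where "c = w $ Suc d"
  have w: "lead (Suc d) c w"
    unfolding c_def w_def by (rule lead_Suc[OF PQ])
  define y where "y = g - fps_X"
  define z where "z = Q - fps_X"
  have zeros: "f $ 0 = 0" "g $ 0 = 0" "Q $ 0 = 0" "P $ 0 = 0"
    using carr PQ pos by (auto simp: nottingham_carrier_iff lead_def)
  \<comment> \<open>\<open>P = Q + w\<close>: expand \<open>y \<circ> P\<close> around \<open>y \<circ> Q\<close>, and \<open>w \<circ> g\<close> around \<open>w \<circ> x\<close>.\<close>
  have left: "lead (Suc k + d) (of_nat (Suc k) * a * c) ((y oo P) - (y oo Q))"
    using lead_compose_change[OF carr(3) gk, of d c P] w pos by (simp add: y_def w_def)
  have right: "lead (Suc d + k) (of_nat (Suc d) * c * a) ((w oo g) - w)"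
    using lead_compose_diff[OF w gk] pos by (simp add: compose_diff_def)
  have diff: "lead (Suc (d + k)) (of_nat (Suc d) * c * a - of_nat (Suc k) * a * c)
      (((w oo g) - w) - ((y oo P) - (y oo Q)))"
    using lead_diff[of "Suc (d + k)"] left right by (simp add: add_ac)
  \<comment> \<open>What is left of \<open>g \<circ> P = P \<circ> g\<close> compares \<open>g \<circ> Q\<close> with \<open>Q \<circ> g\<close>. Since \<open>f\<close> commutes with \<open>Q\<close>,
    only \<open>g - f\<close> contributes, through \<open>Q - x\<close>: order at least \<open>n + r + 1\<close>.\<close>
  have e1: "lead (Suc n + r) (of_nat (Suc n) * (g - f) $ Suc n * (Q - fps_X) $ Suc r)
      (compose_diff Q (g - f))"
    by (rule lead_compose_diff[OF lead_Suc[OF gf] lead_Suc[OF Q] pos(3)])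
  have e2: "lead (Suc r + n) (of_nat (Suc r) * (Q - fps_X) $ Suc r * (g - f) $ Suc n)
      ((z oo g) - (z oo f))"
    unfolding z_def by (rule lead_compose_change[OF carr(1) lead_Suc[OF Q] lead_Suc[OF gf] pos(2)])
  have "((w oo g) - w) - ((y oo P) - (y oo Q)) = compose_diff Q (g - f) - ((z oo g) - (z oo f))"
    using commute zeros
    by (simp add: w_def y_def z_def compose_diff_def fps_compose_sub_distrib algebra_simps)
  moreover have "lead (Suc (d + k)) 0 (compose_diff Q (g - f) - ((z oo g) - (z oo f)))"
    using lead_diff[OF lead_weaken[OF e1, of "Suc (d + k)"] lead_weaken[OF e2, of "Suc (d + k)"]] small
    by simp
  ultimately have "of_nat (Suc d) * c * a - of_nat (Suc k) * a * c = 0"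
    using diff by (simp add: lead_def)
  then have "(of_nat d - of_nat k) * a * c = 0"
    by (simp add: algebra_simps)
  then have "c = 0" by (rule cancel)
  then show ?thesis using w by (simp add: w_def)
qed

lemma of_int_cancel_prime:
  fixes x :: "'a::comm_ring_1"
  assumes "prime p" "of_nat p = (0 :: 'a)" "\<not> int p dvd z" "of_int z * x = 0"
  shows "x = 0"
proof -
  have "coprime (int p) z"
    using assms by (intro prime_imp_coprime) auto
  then obtain s t where st: "s * int p + t * z = 1"
    by (metis bezout_int coprime_imp_gcd_eq_1)
  have "x = of_int (s * int p + t * z) * x"
    by (simp add: st)
  also have "\<dots> = of_int t * (of_int z * x)"
    using assms(2) by (simp add: algebra_simps)
  finally show ?thesis using assms(4) by simp
qed

lemma iterate_commute:
  fixes f :: "'a::comm_ring_1 fps"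
  assumes "f \<in> carrier nottingham"
  shows "f oo iterate f j = iterate f j oo f"
  using nottingham.nat_pow_Suc2[OF assms, of j] by simp

text \<open>
  Iteration of \<open>commuting_gain\<close> from the basic bound on, with \<open>P\<close> and \<open>Q\<close> the \<open>p\<close>-th iterates of
  \<open>g\<close> and \<open>f\<close>. At \<open>d = n + (p - 1) k + i\<close> its hypothesis \<open>d + k < n + r\<close> reads \<open>p k + i < r\<close>, and
  \<open>d - k\<close> is \<open>n + i - 2 k\<close> modulo \<open>p\<close>.
\<close>

lemma iterate_prime_diff_cancellative:
  fixes f g :: "'a::comm_ring_1 fps"
  assumes p: "prime p" "of_nat p = (0 :: 'a)"
    and fg: "f \<in> carrier nottingham" "g \<in> carrier nottingham"
    and k: "1 \<le> k" "k \<le> n"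
    and fk: "lead k 0 (f - fps_X)" and gf: "lead n 0 (g - f)"
    and gk: "lead (Suc k) a (g - fps_X)" and a: "\<And>c. a * c = 0 \<Longrightarrow> c = 0"
    and Q: "lead r 0 (iterate f p - fps_X)"
    and j: "\<And>i. i < j \<Longrightarrow> p * k + i < r \<and> \<not> int p dvd int n + int i - 2 * int k"
  shows "lead (n + (p - 1) * k + j) 0 (iterate g p - iterate f p)"
  using j
proof (induction j)
  case 0
  then show ?case using iterate_prime_diff_basic[OF p fg k fk gf] by simp
next
  case (Suc j)
  let ?d = "n + (p - 1) * k + j"
  have p1: "1 \<le> p" using prime_gt_0_nat[OF p(1)] by simp
  have pk: "p * k = (p - 1) * k + k" using p1 by (cases p) auto
  have j: "p * k + j < r" "\<not> int p dvd int n + int j - 2 * int k"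
    using Suc.prems by auto
  have "int ?d - int k = (int n + int j - 2 * int k) + int p * int k"
    using p1 by (cases p) (simp_all add: algebra_simps)
  then have nd: "\<not> int p dvd int ?d - int k"
    using j(2) by (metis dvd_add_left_iff dvd_triv_left)
  have "lead (Suc ?d) 0 (iterate g p - iterate f p)"
  proof (rule commuting_gain[OF fg iterate_closed[OF fg(1)] iterate_commute[OF fg(2)]
          iterate_commute[OF fg(1)] gk gf Q])
    show "lead ?d 0 (iterate g p - iterate f p)" using Suc by auto
    show "1 \<le> k" "1 \<le> n" "1 \<le> r" "1 \<le> ?d" using k j by auto
    show "?d + k < n + r" using j(1) pk by simp
    fix c assume "(of_nat ?d - of_nat k) * a * c = 0"
    then have "of_int (int ?d - int k) * (a * c) = 0" by (simp add: mult.assoc)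
    then have "a * c = 0" by (rule of_int_cancel_prime[OF p nd])
    then show "c = 0" by (rule a)
  qed
  then show ?case by simp
qed

section \<open>Specialising a generic perturbation\<close>

definition fps_at_zero :: "'a::comm_ring_1 poly fps \<Rightarrow> 'a fps" where
  "fps_at_zero F = Abs_fps (\<lambda>i. poly (F $ i) 0)"

lemma fps_at_zero_nth [simp]: "fps_at_zero F $ i = poly (F $ i) 0"
  by (simp add: fps_at_zero_def)

lemma fps_at_zero_diff: "fps_at_zero (F - G) = fps_at_zero F - fps_at_zero G"
  by (simp add: fps_eq_iff)

lemma fps_at_zero_X: "fps_at_zero fps_X = fps_X"
  by (simp add: fps_eq_iff)

lemma fps_at_zero_power: "fps_at_zero (F ^ n) = fps_at_zero F ^ n"
proof (induction n)
  case 0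
  show ?case by (simp add: fps_eq_iff)
next
  case (Suc n)
  have "fps_at_zero (F * F ^ n) = fps_at_zero F * fps_at_zero (F ^ n)"
    by (simp add: fps_eq_iff fps_mult_nth poly_sum)
  then show ?case by (simp add: Suc)
qed

lemma fps_at_zero_compose: "fps_at_zero (F oo G) = fps_at_zero F oo fps_at_zero G"
  by (simp add: fps_eq_iff fps_compose_nth poly_sum flip: fps_at_zero_power)

lemma fps_at_zero_iterate: "fps_at_zero (iterate F j) = iterate (fps_at_zero F) j"
  by (induction j) (simp_all add: fps_at_zero_X fps_at_zero_compose)

lemma lead_fps_at_zero: "lead d 0 F \<Longrightarrow> lead d 0 (fps_at_zero F)"
  by (simp add: lead_def)

text \<open>
  The series \<open>f + t x\<^sup>k\<^sup>+\<^sup>1\<close> over \<open>'a[t]\<close>. Its coefficient at \<open>x\<^sup>k\<^sup>+\<^sup>1\<close> is monic in \<open>t\<close>, so it can be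
  cancelled whatever \<open>'a\<close> is, while \<open>t = 0\<close> gives back \<open>f\<close>.
\<close>

definition perturb :: "nat \<Rightarrow> 'a::comm_ring_1 fps \<Rightarrow> 'a poly fps" where
  "perturb k f = Abs_fps (\<lambda>i. pCons (f $ i) (if i = Suc k then 1 else 0))"

lemma perturb_nth: "perturb k f $ i = pCons (f $ i) (if i = Suc k then 1 else 0)"
  by (simp add: perturb_def)

lemma fps_at_zero_perturb: "fps_at_zero (perturb k f) = f"
  by (simp add: fps_eq_iff perturb_nth)

lemma perturb_carrier:
  "f \<in> carrier nottingham \<Longrightarrow> 1 \<le> k \<Longrightarrow> perturb k f \<in> carrier nottingham"
  by (simp add: nottingham_carrier_iff perturb_nth one_pCons)

lemma lead_perturb_diff: "lead n 0 (g - f) \<Longrightarrow> lead n 0 (perturb k g - perturb k f)"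
  by (simp add: lead_def perturb_nth)

lemma lead_perturb:
  assumes "lead k 0 (f - fps_X)" "1 \<le> k"
  shows "lead k 0 (perturb k f - fps_X)"
    and "lead (Suc k) [:f $ Suc k, 1:] (perturb k f - fps_X)"
proof -
  have "(perturb k f - fps_X) $ i = 0" if "i \<le> k" for i
  proof -
    have "f $ i = fps_X $ i"
      using assms that by (auto simp: lead_def le_less)
    then show ?thesis using that by (auto simp: perturb_nth one_pCons)
  qed
  then show "lead k 0 (perturb k f - fps_X)"
    and "lead (Suc k) [:f $ Suc k, 1:] (perturb k f - fps_X)"
    using assms(2) by (auto simp: lead_def perturb_nth)
qed

lemma monic_linear_cancel:
  fixes c :: "'a::comm_ring_1 poly"
  assumes "[:a, 1:] * c = 0"
  shows "c = 0"
proof -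
  have "coeff ([:a, 1:] * c) (Suc (degree c)) = coeff c (degree c)"
    by (simp add: coeff_eq_0)
  then show ?thesis unfolding assms by simp
qed

text \<open>
  Both series are perturbed by the same \<open>t x\<^sup>k\<^sup>+\<^sup>1\<close>, which leaves their difference unchanged. The
  cancellative case is used twice over \<open>'a[t]\<close>: comparing \<open>f\<close> with the identity gives
  \<open>D(f\<^sup>p) \<ge> p k + (k mod p)\<close>, and this is the \<open>r\<close> needed to compare \<open>g\<close> with \<open>f\<close>.
\<close>

lemma iterate_prime_diff_gain:
  fixes f g :: "'a::comm_ring_1 fps"
  assumes p: "prime p" "of_nat p = (0 :: 'a)"
    and fg: "f \<in> carrier nottingham" "g \<in> carrier nottingham"
    and k: "1 \<le> k" "k \<le> n"
    and fk: "lead k 0 (f - fps_X)" and gf: "lead n 0 (g - f)"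
    and j: "\<And>i. i < j \<Longrightarrow> i < k mod p \<and> \<not> int p dvd int n + int i - 2 * int k"
  shows "lead (n + (p - 1) * k + j) 0 (iterate g p - iterate f p)"
proof -
  let ?f = "perturb k f" and ?g = "perturb k g"
  have p': "of_nat p = (0 :: 'a poly)"
    using p(2) by (simp add: of_nat_poly)
  have fg': "?f \<in> carrier nottingham" "?g \<in> carrier nottingham"
    using perturb_carrier fg k by blast+
  have gf': "lead n 0 (?g - ?f)" by (rule lead_perturb_diff[OF gf])
  have fk': "lead k 0 (?f - fps_X)" and fk'': "lead (Suc k) [:f $ Suc k, 1:] (?f - fps_X)"
    using lead_perturb[OF fk] k by auto
  have "lead k 0 (g - f)"
    using gf k(2) by (rule lead_mono)
  from lead_add[OF this fk] have "lead k 0 (g - fps_X)" by simp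
  then have gk'': "lead (Suc k) [:g $ Suc k, 1:] (?g - fps_X)"
    using lead_perturb(2) k by blast
  have p1: "1 \<le> p" using prime_gt_0_nat[OF p(1)] by simp
  have pk: "p * k = (p - 1) * k + k" using p1 by (cases p) auto
  \<comment> \<open>The identity equals its own \<open>p\<close>-th iterate, so here \<open>r\<close> could be arbitrarily large; the gain
    stops only at \<open>i = k mod p\<close>, where \<open>k + i \<equiv> 2 k\<close>.\<close>
  have Q: "lead (k + (p - 1) * k + k mod p) 0 (iterate ?f p - iterate fps_X p)"
  proof (rule iterate_prime_diff_cancellative[OF p(1) p' fps_X_nottingham fg'(1) k(1) order_refl _ fk' fk''
        monic_linear_cancel, where r = "p * k + k mod p"])
    fix i assume i: "i < k mod p"
    have "\<not> int p dvd int i - int k"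
    proof
      assume "int p dvd int i - int k"
      then have "int i mod int p = int k mod int p" by (simp add: mod_eq_dvd_iff)
      then have "i mod p = k mod p" by (metis of_nat_eq_iff zmod_int)
      moreover have "i mod p = i"
        using i p1 mod_less_divisor[of p k] by (intro mod_less) linarith
      ultimately show False using i by simp
    qed
    then show "p * k + i < p * k + k mod p \<and> \<not> int p dvd int k + int i - 2 * int k"
      using i by (simp add: algebra_simps)
  qed (simp_all add: iterate_X lead_def)
  have "lead (n + (p - 1) * k + j) 0 (iterate ?g p - iterate ?f p)"
  proof (rule iterate_prime_diff_cancellative[OF p(1) p' fg' k fk' gf' gk'' monic_linear_cancel])
    show "lead (p * k + k mod p) 0 (iterate ?f p - fps_X)"
      using Q by (simp add: iterate_X pk add_ac)
  qed (use j in auto)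
  then have "lead (n + (p - 1) * k + j) 0 (fps_at_zero (iterate ?g p - iterate ?f p))"
    by (rule lead_fps_at_zero)
  then show ?thesis
    by (simp add: fps_at_zero_diff fps_at_zero_iterate fps_at_zero_perturb)
qed

section \<open>The excess and its behaviour under p-th powers\<close>

text \<open>
  The two bounds are the two obstacles to the gain: the order of \<open>f\<^sup>p - x\<close>, and the congruence
  \<open>n + i \<equiv> 2 k\<close>, whose least solution \<open>i\<close> is the residue of \<open>2 k - n\<close>.
\<close>

lemma depth_excess_not_dvd:
  assumes "prime p" "\<not> p dvd k"
  shows "int (depth_excess p k n) = min (int k mod int p) ((2 * int k - int n) mod int p)"
proof -
  define r where "r = (2 * int k - int n) mod int p"
  define attains where
    "attains = (\<lambda>i. i \<le> k mod p \<and> int n mod int p = (2 * int k - int i) mod int p)"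
  have p0: "0 < p" using assms(1) by (simp add: prime_gt_0_nat)
  have r0: "0 \<le> r" "r < int p" using p0 by (auto simp: r_def)
  have kp: "k mod p < p" using p0 by simp
  have attains: "attains i \<longleftrightarrow> int i = r \<and> r \<le> int (k mod p)" for i
  proof -
    have "int n mod int p = (2 * int k - int i) mod int p \<longleftrightarrow> int i mod int p = r"
    proof -
      have "int p dvd int n - (2 * int k - int i) \<longleftrightarrow> int p dvd int i - (2 * int k - int n)"
        by (simp add: algebra_simps)
      then show ?thesis by (simp add: r_def mod_eq_dvd_iff)
    qed
    moreover have "int i mod int p = int i" if "i \<le> k mod p"
      using that kp by simp
    ultimately show ?thesis
      using r0 by (auto simp: attains_def)
  qed
  have e: "depth_excess p k n = (if \<exists>i. attains i then THE i. attains i else k mod p)"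
    unfolding depth_excess_def attains_def Let_def by (simp only: assms(2) if_False)
  show ?thesis
  proof (cases "r \<le> int (k mod p)")
    case True
    then have "attains = (\<lambda>i. i = nat r)"
      using r0 by (auto simp: attains fun_eq_iff)
    then have "depth_excess p k n = nat r" by (simp add: e)
    then show ?thesis using True r0 by (simp add: r_def zmod_int)
  next
    case False
    then show ?thesis by (simp add: e attains r_def zmod_int)
  qed
qed

lemma iterate_prime_diff:
  fixes f g :: "'a::comm_ring_1 fps"
  assumes p: "prime p" "of_nat p = (0 :: 'a)"
    and fg: "f \<in> carrier nottingham" "g \<in> carrier nottingham"
    and k: "1 \<le> k" "k \<le> n"
    and fk: "lead k 0 (f - fps_X)" and gf: "lead n 0 (g - f)"
  shows "lead (n + (p - 1) * k + depth_excess p k n) 0 (iterate g p - iterate f p)"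
proof (cases "p dvd k")
  case True
  then consider "depth_excess p k n = 0" | "depth_excess p k n = 1" "p dvd n" "k < n"
    using k by (cases "p dvd n"; cases "n = k") (auto simp: depth_excess_def Let_def)
  then show ?thesis
  proof cases
    case 1
    then show ?thesis using iterate_prime_diff_basic[OF p fg k fk gf] by simp
  next
    case 2
    then show ?thesis using iterate_prime_diff_dvd[OF p fg k(1) 2(3) True 2(2) fk gf] by simp
  qed
next
  case False
  note e = depth_excess_not_dvd[OF p(1) False, of n]
  have p0: "0 < p" using p(1) by (simp add: prime_gt_0_nat)
  show ?thesis
  proof (rule iterate_prime_diff_gain[OF p fg k fk gf])
    fix i assume "i < depth_excess p k n"
    then have i: "int i < int k mod int p" "int i < (2 * int k - int n) mod int p"
      using e by auto
    have "\<not> int p dvd int n + int i - 2 * int k"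
    proof
      assume "int p dvd int n + int i - 2 * int k"
      then have "int p dvd int i - (2 * int k - int n)" by (simp add: algebra_simps)
      then have "int i mod int p = (2 * int k - int n) mod int p" by (simp add: mod_eq_dvd_iff)
      moreover have "int i mod int p = int i"
        using i(1) p0 pos_mod_bound[of "int p" "int k"] by (intro mod_pos_pos_trivial) linarith+
      ultimately show False using i(2) by simp
    qed
    moreover have "i < k mod p" using i(1) by (simp flip: zmod_int)
    ultimately show "i < k mod p \<and> \<not> int p dvd int n + int i - 2 * int k" by blast
  qed
qed

lemma depth_excess_self:
  assumes "prime p"
  shows "k mod p \<le> depth_excess p k k"
proof (cases "p dvd k")
  case False
  show ?thesis
    using depth_excess_not_dvd[OF assms False, of k] by (simp flip: zmod_int)
qed auto

text \<open>
  Passing to \<open>p\<close>-th powers replaces \<open>(k, n)\<close> by \<open>(k', n')\<close>, where \<open>k' \<equiv> k\<close> and \<open>n' \<equiv> n - k + e(k, n)\<close>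
  modulo \<open>p\<close>, so \<open>2 k' - n'\<close> is \<open>(2 k - n) - e(k, n) + k\<close>. If the excess is the residue \<open>r\<close> of
  \<open>2 k - n\<close>, the new residue is \<open>k mod p\<close>; if it is \<open>k mod p < r\<close>, the new residue is \<open>r\<close> again.
  So from the second step on the excess is at least \<open>k mod p\<close>.
\<close>

lemma depth_excess_next:
  assumes p: "prime p" and k: "k \<le> n"
  defines "k' \<equiv> p * k + k mod p" and "n' \<equiv> n + (p - 1) * k + depth_excess p k n"
  shows "k' \<le> n'" and "k' mod p = k mod p" and "k mod p \<le> depth_excess p k' n'"
proof -
  have p0: "0 < p" using p by (simp add: prime_gt_0_nat)
  then have pk: "p * k = (p - 1) * k + k" by (cases p) auto
  show k'_mod: "k' mod p = k mod p" by (simp add: k'_def)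
  show "k' \<le> n'"
  proof (cases "p dvd k")
    case True
    then show ?thesis using k pk by (simp add: k'_def n'_def)
  next
    case False
    define e where "e = depth_excess p k n"
    have e: "int e = min (int k mod int p) ((2 * int k - int n) mod int p)"
      unfolding e_def by (rule depth_excess_not_dvd[OF p False])
    have "k mod p \<le> (n - k) + e"
    proof (rule ccontr)
      assume neg: "\<not> ?thesis"
      then have s: "n - k < k mod p" "e < k mod p" by auto
      have "(2 * int k - int n) mod int p = int (k mod p) - int (n - k)"
      proof -
        have "(2 * int k - int n) mod int p = (int k - int (n - k)) mod int p"
          using k by (simp add: of_nat_diff)
        also have "\<dots> = (int k mod int p - int (n - k)) mod int p"
          by (simp add: mod_diff_left_eq)
        also have "\<dots> = (int (k mod p) - int (n - k)) mod int p"
          by (simp add: zmod_int)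
        also have "\<dots> = int (k mod p) - int (n - k)"
          using s(1) mod_less_divisor[OF p0, of k] by (intro mod_pos_pos_trivial) linarith+
        finally show ?thesis .
      qed
      then have "int e = min (int (k mod p)) (int (k mod p) - int (n - k))"
        unfolding e zmod_int by simp
      then show False using neg by linarith
    qed
    then show ?thesis using k pk by (simp add: k'_def n'_def e_def)
  qed
  show "k mod p \<le> depth_excess p k' n'"
  proof (cases "p dvd k")
    case True
    then show ?thesis by auto
  next
    case False
    define e where "e = depth_excess p k n"
    define r where "r = (2 * int k - int n) mod int p"
    have e: "int e = min (int k mod int p) r"
      unfolding e_def r_def by (rule depth_excess_not_dvd[OF p False])
    have False': "\<not> p dvd k'" using False k'_mod by (simp add: dvd_eq_mod_eq_0)
    define q where "q = (2 * int k - int n) div int p"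
    have qr: "2 * int k - int n = int p * q + r" by (simp add: q_def r_def)
    define u where "u = int k div int p"
    have u: "int k = int p * u + int (k mod p)" by (simp add: u_def zmod_int)
    have "2 * int k' - int n' = 2 * int p * int k + 2 * int (k mod p) - int n - (int p - 1) * int k - int e"
      using p0 by (cases p) (simp_all add: k'_def n'_def e_def algebra_simps)
    also have "\<dots> = int p * (int k + q - 2 * u) + (r + int k - int e) + 2 * (int p * u + int (k mod p) - int k)"
      using qr by (simp add: algebra_simps)
    also have "\<dots> = (r + int k - int e) + int p * (int k + q - 2 * u)"
      using u by simp
    finally have "(2 * int k' - int n') mod int p = (r + int k - int e) mod int p"
      by simp
    also have "\<dots> = (r + int (k mod p) - int e) mod int p"
      by (metis (no_types) add_diff_eq diff_add_eq mod_add_left_eq zmod_int add.commute)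
    also have "int (k mod p) \<le> \<dots>"
    proof (cases "r \<le> int (k mod p)")
      case True
      then have "int e = r" using e by (simp add: zmod_int)
      then show ?thesis by (simp add: zmod_int)
    next
      case False
      then have "int e = int (k mod p)" using e by (simp add: zmod_int)
      then show ?thesis using False by (simp add: r_def)
    qed
    finally have "int (k mod p) \<le> (2 * int k' - int n') mod int p" .
    then show ?thesis
      using depth_excess_not_dvd[OF p False', of n'] k'_mod by (simp add: zmod_int [symmetric])
  qed
qed

section \<open>Iterates of prime-power order and depth\<close>

text \<open>
  The induction applies the bound for \<open>p\<^sup>m\<close> to \<open>f\<^sup>p\<close> and \<open>g\<^sup>p\<close>. The multiples of \<open>k mod p\<close> add up
  because \<open>(p\<^sup>m\<^sup>+\<^sup>1 - p) / (p - 1) = (p\<^sup>m - p) / (p - 1) + (p\<^sup>m - 1) + 1\<close>: the middle summand comes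
  from \<open>D(f\<^sup>p) \<ge> p k + (k mod p)\<close> and the last one from \<open>depth_excess_next\<close>.
\<close>

lemma iterate_prime_power_diff:
  fixes f g :: "'a::comm_ring_1 fps"
  assumes p: "prime p" "of_nat p = (0 :: 'a)"
    and fg: "f \<in> carrier nottingham" "g \<in> carrier nottingham"
    and k: "1 \<le> k" "k \<le> n"
    and fk: "lead k 0 (f - fps_X)" and gf: "lead n 0 (g - f)"
  shows "lead (n + (p ^ Suc m - 1) * k + (p ^ Suc m - p) div (p - 1) * (k mod p) + depth_excess p k n) 0
    (iterate g (p ^ Suc m) - iterate f (p ^ Suc m))"
  using fg k fk gf
proof (induction m arbitrary: f g k n)
  case 0
  then show ?case using iterate_prime_diff[OF p] by simp
next
  case (Suc m)
  note fg = Suc.prems(1,2) and k = Suc.prems(3,4) and fk = Suc.prems(5) and gf = Suc.prems(6)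
  define k' where "k' = p * k + k mod p"
  define n' where "n' = n + (p - 1) * k + depth_excess p k n"
  define e' where "e' = depth_excess p k' n'"
  have succ: "k' \<le> n'" "k' mod p = k mod p" "k mod p \<le> e'"
    unfolding k'_def n'_def e'_def using depth_excess_next[OF p(1) k(2)] by auto
  have p2: "2 \<le> p" using p(1) by (rule prime_ge_2_nat)
  have k'1: "1 \<le> k'" using k p2 by (cases p) (auto simp: k'_def)
  have pk: "p * k = (p - 1) * k + k" using p2 by (cases p) auto
  have "lead (k + (p - 1) * k + depth_excess p k k) 0 (iterate f p - fps_X)"
    using iterate_prime_diff[OF p fps_X_nottingham fg(1) k(1) order_refl _ fk] by (simp add: iterate_X lead_def)
  then have f': "lead k' 0 (iterate f p - fps_X)"
    by (rule lead_mono) (use depth_excess_self[OF p(1), of k] pk in \<open>simp add: k'_def\<close>)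
  have g': "lead n' 0 (iterate g p - iterate f p)"
    unfolding n'_def by (rule iterate_prime_diff[OF p fg k fk gf])
  have "lead (n' + (p ^ Suc m - 1) * k' + (p ^ Suc m - p) div (p - 1) * (k' mod p) + e') 0
      (iterate (iterate g p) (p ^ Suc m) - iterate (iterate f p) (p ^ Suc m))"
    unfolding e'_def
    using Suc.IH[OF iterate_closed[OF fg(1)] iterate_closed[OF fg(2)] k'1 succ(1) f' g'] .
  then have big: "lead (n' + (p ^ Suc m - 1) * k' + (p ^ Suc m - p) div (p - 1) * (k mod p) + e') 0
      (iterate g (p ^ Suc (Suc m)) - iterate f (p ^ Suc (Suc m)))"
    using fg by (simp add: nottingham.nat_pow_pow succ(2))
  have pm: "p ^ Suc m = (p ^ Suc m - 1) + 1" using p2 by simp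
  have s1: "p ^ Suc (Suc m) - 1 = (p ^ Suc m - 1) * p + (p - 1)"
    using p2 by (simp add: algebra_simps)
  have s2: "(p ^ Suc (Suc m) - p) div (p - 1) = (p ^ Suc m - p) div (p - 1) + p ^ Suc m"
  proof -
    have "p \<le> p ^ Suc m" using p2 by simp
    then have "p ^ Suc (Suc m) - p = (p ^ Suc m - p) + p ^ Suc m * (p - 1)"
      using p2 by (cases p) (simp_all add: algebra_simps)
    also have "\<dots> div (p - 1) = p ^ Suc m + (p ^ Suc m - p) div (p - 1)"
      using p2 by (intro div_mult_self1) simp
    finally show ?thesis by simp
  qed
  define P c where "P = p ^ Suc m - 1" and "c = (p ^ Suc m - p) div (p - 1)"
  have "n + (p ^ Suc (Suc m) - 1) * k + (p ^ Suc (Suc m) - p) div (p - 1) * (k mod p) + depth_excess p k n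
     = n + (P * p + (p - 1)) * k + (c + (P + 1)) * (k mod p) + depth_excess p k n"
    unfolding s1 s2 P_def c_def using pm by simp
  also have "\<dots> = n' + P * k' + c * (k mod p) + k mod p"
    by (simp add: n'_def k'_def distrib_left distrib_right mult_ac add_ac)
  also have "\<dots> \<le> n' + P * k' + c * (k mod p) + e'"
    using succ(3) by simp
  finally show ?case
    using big unfolding P_def c_def by (rule lead_mono[rotated])
qed

lemma depth_ge_iff:
  fixes f :: "'a::comm_ring_1 fps"
  assumes "f \<in> carrier nottingham" "1 \<le> d"
  shows "enat d \<le> depth f \<longleftrightarrow> lead d 0 (f - fps_X)"
proof
  assume "lead d 0 (f - fps_X)"
  then have "f \<in> nottingham_filtration d"
    using assms(1) unfolding nottingham_filtration_def X_power_dvd_iff_lead by simp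
  then show "enat d \<le> depth f"
    using assms(2) unfolding depth_def by (intro Sup_upper) auto
next
  assume "enat d \<le> depth f"
  then have "enat (d - 1) < depth f"
    using assms(2) by (metis Suc_ile_eq Suc_pred' less_eq_Suc_le One_nat_def)
  then obtain e where e: "d - 1 < e" "f \<in> nottingham_filtration e"
    unfolding depth_def less_Sup_iff by auto
  then have "lead e 0 (f - fps_X)"
    unfolding nottingham_filtration_def X_power_dvd_iff_lead by simp
  then show "lead d 0 (f - fps_X)"
    by (rule lead_mono) (use e(1) in simp)
qed

lemma lead_compose_0:
  fixes f h :: "'a::comm_ring_1 fps"
  assumes "f $ 0 = 0" "lead d 0 h"
  shows "lead d 0 (h oo f)"
proof -
  have "(\<Sum>i=0..n. h $ i * (f ^ i) $ n) = 0" if "n \<le> d" for n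
    using that assms(2) by (intro sum.neutral) (auto simp: lead_def le_less)
  then show ?thesis by (simp add: lead_def fps_compose_nth)
qed

text \<open>
  Composition with an invertible series preserves orders of vanishing, so the depth of a quotient
  is an order of vanishing of a difference.
\<close>

lemma depth_quotient_ge_iff:
  fixes f g :: "'a::comm_ring_1 fps"
  assumes fg: "f \<in> carrier nottingham" "g \<in> carrier nottingham" and d: "1 \<le> d"
  shows "enat d \<le> depth (g \<otimes>\<^bsub>nottingham\<^esub> inv\<^bsub>nottingham\<^esub> f) \<longleftrightarrow> lead d 0 (g - f)"
proof -
  define i where "i = inv\<^bsub>nottingham\<^esub> f"
  have i: "i \<in> carrier nottingham" unfolding i_def using fg by simp
  have fi: "f oo i = fps_X" and "if": "i oo f = fps_X"
    using nottingham.r_inv[OF fg(1)] nottingham.l_inv[OF fg(1)] by (simp_all add: i_def)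
  have zeros: "f $ 0 = 0" "i $ 0 = 0" "g $ 0 = 0"
    using fg i by (auto simp: nottingham_carrier_iff)
  have "enat d \<le> depth (g oo i) \<longleftrightarrow> lead d 0 ((g oo i) - fps_X)"
    by (rule depth_ge_iff[OF nottingham_compose_closed[OF fg(2) i] d])
  also have "\<dots> \<longleftrightarrow> lead d 0 (g - f)"
  proof
    assume "lead d 0 ((g oo i) - fps_X)"
    from lead_compose_0[OF zeros(1) this] show "lead d 0 (g - f)"
      using zeros "if" by (simp add: fps_compose_sub_distrib fps_compose_associative)
  next
    assume "lead d 0 (g - f)"
    from lead_compose_0[OF zeros(2) this] show "lead d 0 ((g oo i) - fps_X)"
      using fi by (simp add: fps_compose_sub_distrib)
  qed
  finally show ?thesis by (simp add: i_def)
qed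

theorem corollary2:
  fixes p n k m :: nat and f g :: "'a::comm_ring_1 fps"
  assumes "prime p" and "CHAR('a) = p"
    and "1 \<le> k" and "k \<le> n"
    and "f \<in> carrier nottingham" and "g \<in> carrier nottingham"
    and "enat k \<le> depth f"
    and "enat n \<le> depth (g \<otimes>\<^bsub>nottingham\<^esub> inv\<^bsub>nottingham\<^esub> f)"
    and "1 \<le> m"
  shows "enat (n + (p ^ m - 1) * k + (p ^ m - p) div (p - 1) * (k mod p) + depth_excess p k n)
    \<le> depth (g [^]\<^bsub>nottingham\<^esub> (p ^ m) \<otimes>\<^bsub>nottingham\<^esub> f [^]\<^bsub>nottingham\<^esub> (- int (p ^ m)))"
proof -
  have p: "of_nat p = (0 :: 'a)"
    using assms(2) of_nat_CHAR[where 'a = 'a] by simp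
  have fk: "lead k 0 (f - fps_X)"
    using depth_ge_iff assms(3,5,7) by blast
  have gf: "lead n 0 (g - f)"
    using depth_quotient_ge_iff[OF assms(5,6)] assms(3,4,8) by simp
  obtain l where m: "m = Suc l" using assms(9) by (cases m) auto
  have "lead (n + (p ^ m - 1) * k + (p ^ m - p) div (p - 1) * (k mod p) + depth_excess p k n) 0
      (iterate g (p ^ m) - iterate f (p ^ m))"
    unfolding m by (rule iterate_prime_power_diff[OF assms(1) p assms(5,6,3,4) fk gf])
  then show ?thesis
    unfolding nottingham.int_pow_neg_int[OF assms(5)]
    using depth_quotient_ge_iff[OF iterate_closed[OF assms(5)] iterate_closed[OF assms(6)]]
      assms(3,4) by simp
qed

end
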